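(* Let $O=(X,\le_O)$ and $P=(Y,\le_P)$ be posets on disjoint sets, and let $R\subseteq X\times Y$ satisfy $(\le_O)R\cup R(\le_P)\subseteq R$. Let $O\oplus_R P$ be the poset $(X\cup Y,\ \le_O\cup R\cup\le_P)$. Then the set of downsets of $O\oplus_R P$ is $$\mathcal{D}(O\oplus_R P)=\bigcup_{D\in\mathcal{D}(P)}\{D\cup RD\cup E\mid E\in\mathcal{D}(O-RD)\},$$ and this union is disjoint. Hence, if $X$ and $Y$ are finite, $$d(O\oplus_R P)=\sum_{D\in\mathcal{D}(P)} d(O-RD).$$
   Context: For relations $R\subseteq X\times Y$, $S$ a relation, $RS=\{(x,z)\mid\exists y:(x,y)\in R,(y,z)\in S\}$ (and similarly $(\le_O)R$). For $D\subseteq Y$, $RD=\{x\in X\mid \exists y\in D:(x,y)\in R\}$. $\mathcal{D}(\cdot)$ denotes the set of downsets of a poset, $d(\cdot)$ its cardinality, and $O-S$ the subposet of $O$ induced on $X\setminus S$. *)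

theory Defs
  imports Main "HOL-Library.Disjoint_Sets"
begin

type_synonym 'a pos = "'a set \<times> 'a rel"

definition is_poset :: "'a pos \<Rightarrow> bool" where
  "is_poset P \<longleftrightarrow> partial_order_on (fst P) (snd P)"

definition downsets :: "'a pos \<Rightarrow> 'a set set" where
  "downsets P = {D. D \<subseteq> fst P \<and> (\<forall>y\<in>D. \<forall>x\<in>fst P. (x, y) \<in> snd P \<longrightarrow> x \<in> D)}"

definition num_downsets :: "'a pos \<Rightarrow> nat" where
  "num_downsets P = card (downsets P)"

definition pos_minus :: "'a pos \<Rightarrow> 'a set \<Rightarrow> 'a pos" where
  "pos_minus P S = (fst P - S, Restr (snd P) (fst P - S))"

definition osum :: "'a pos \<Rightarrow> 'a rel \<Rightarrow> 'a pos \<Rightarrow> 'a pos" where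
  "osum P R Q = (fst P \<union> fst Q, snd P \<union> R \<union> snd Q)"

text \<open>\<open>RD\<close> collects the left partners of elements of \<open>D\<close>, so it is the image of \<open>D\<close> under
  the converse of \<open>R\<close>.\<close>

abbreviation rel_pre :: "'a rel \<Rightarrow> 'a set \<Rightarrow> 'a set" where
  "rel_pre R D \<equiv> R\<inverse> `` D"

end

theory Submission
  imports Defs
begin

text \<open>
  A downset \<open>W\<close> of the sum is determined by its trace \<open>D = W \<inter> Y\<close>, a downset of \<open>P\<close> that
  forces \<open>RD \<subseteq> W\<close>, and by the remainder \<open>E = (W \<inter> X) - RD\<close>, which can be any downset of
  \<open>O - RD\<close> because \<open>RD\<close> is itself a downset of \<open>O\<close>. The trace separates the members of
  the union, and \<open>D\<close> and \<open>W\<close> together recover \<open>E\<close>.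
\<close>

lemma is_poset_iff:
  "is_poset (A, r) \<longleftrightarrow>
    r \<subseteq> A \<times> A \<and> (\<forall>x\<in>A. (x, x) \<in> r) \<and>
    (\<forall>x y z. (x, y) \<in> r \<longrightarrow> (y, z) \<in> r \<longrightarrow> (x, z) \<in> r) \<and>
    (\<forall>x y. (x, y) \<in> r \<longrightarrow> (y, x) \<in> r \<longrightarrow> x = y)"
  unfolding is_poset_def partial_order_on_def preorder_on_def refl_on_def trans_def antisym_def
  by auto

lemma mem_downsets_iff:
  "D \<in> downsets (A, r) \<longleftrightarrow> D \<subseteq> A \<and> (\<forall>y\<in>D. \<forall>x\<in>A. (x, y) \<in> r \<longrightarrow> x \<in> D)"
  by (simp add: downsets_def)

lemma mem_downsets_pos_minus_iff:
  "E \<in> downsets (pos_minus (A, r) S) \<longleftrightarrow>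
    E \<subseteq> A - S \<and> (\<forall>y\<in>E. \<forall>x\<in>A - S. (x, y) \<in> r \<longrightarrow> x \<in> E)"
  by (auto simp: downsets_def pos_minus_def)

lemma finite_downsets: "finite A \<Longrightarrow> finite (downsets (A, r))"
  by (rule finite_subset[of _ "Pow A"]) (auto simp: mem_downsets_iff)

lemma finite_downsets_pos_minus: "finite A \<Longrightarrow> finite (downsets (pos_minus (A, r) S))"
  by (simp add: pos_minus_def finite_downsets)

text \<open>Since \<open>X\<close> and \<open>Y\<close> are disjoint, \<open>R\<close> leads only
  from \<open>X\<close> up into \<open>Y\<close> and no pair leads back. So transitivity can only
  mix \<open>R\<close> with one of the two orders, which \<open>comp\<close> absorbs, and no pair of
  \<open>R\<close> can lie on a cycle.\<close>

lemma is_poset_osum: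
  assumes O: "is_poset (X, leO)" and P: "is_poset (Y, leP)"
    and disj: "X \<inter> Y = {}" and R: "R \<subseteq> X \<times> Y"
    and comp: "leO O R \<union> R O leP \<subseteq> R"
  shows "is_poset (osum (X, leO) R (Y, leP))"
proof -
  have O_sub: "leO \<subseteq> X \<times> X" and P_sub: "leP \<subseteq> Y \<times> Y"
    using O P by (auto simp: is_poset_iff)
  have O_R: "(x, z) \<in> R" if "(x, y) \<in> leO" "(y, z) \<in> R" for x y z
    using comp that by blast
  have R_P: "(x, z) \<in> R" if "(x, y) \<in> R" "(y, z) \<in> leP" for x y z
    using comp that by blast
  let ?r = "leO \<union> R \<union> leP"
  have "?r \<subseteq> (X \<union> Y) \<times> (X \<union> Y)"
    using O_sub P_sub R by blast
  moreover have "\<forall>x\<in>X \<union> Y. (x, x) \<in> ?r"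
    using O P by (auto simp: is_poset_iff)
  moreover have "(x, z) \<in> ?r" if "(x, y) \<in> ?r" "(y, z) \<in> ?r" for x y z
  proof -
    have "(x, z) \<in> leO" if "(x, y) \<in> leO" "(y, z) \<in> leO"
      using O that unfolding is_poset_iff by blast
    moreover have "(x, z) \<in> leP" if "(x, y) \<in> leP" "(y, z) \<in> leP"
      using P that unfolding is_poset_iff by blast
    \<comment> \<open>Of the nine combinations only these four survive: the middle point
      \<open>y\<close> lies in exactly one of \<open>X\<close> and \<open>Y\<close>, which limits
      both the pair ending in \<open>y\<close> and the pair starting there.\<close>
    moreover have "(x, y) \<in> leO \<and> (y, z) \<in> leO \<or> (x, y) \<in> leO \<and> (y, z) \<in> R \<or>
        (x, y) \<in> R \<and> (y, z) \<in> leP \<or> (x, y) \<in> leP \<and> (y, z) \<in> leP"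
      using that O_sub P_sub R disj by blast
    ultimately show ?thesis
      using O_R R_P by blast
  qed
  moreover have "x = y" if "(x, y) \<in> ?r" "(y, x) \<in> ?r" for x y
  proof -
    \<comment> \<open>A pair in \<open>R\<close> has no reverse in the sum, because its lower end is
      in \<open>X\<close> and its upper end in \<open>Y\<close>.\<close>
    have "(x, y) \<in> leO \<and> (y, x) \<in> leO \<or> (x, y) \<in> leP \<and> (y, x) \<in> leP"
      using that O_sub P_sub R disj by blast
    then show ?thesis
      using O P unfolding is_poset_iff by blast
  qed
  ultimately show ?thesis
    unfolding osum_def fst_conv snd_conv is_poset_iff by (intro conjI allI impI)
qed

lemma downsets_osum:
  assumes O: "is_poset (X, leO)" and P: "is_poset (Y, leP)"
    and disj: "X \<inter> Y = {}" and R: "R \<subseteq> X \<times> Y"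
    and comp: "leO O R \<union> R O leP \<subseteq> R"
  shows "downsets (osum (X, leO) R (Y, leP)) =
    (\<Union>D\<in>downsets (Y, leP).
       {D \<union> rel_pre R D \<union> E | E. E \<in> downsets (pos_minus (X, leO) (rel_pre R D))})"
    (is "?L = (\<Union>D\<in>_. ?F D)")
proof -
  have O_sub: "leO \<subseteq> X \<times> X" and P_sub: "leP \<subseteq> Y \<times> Y"
    using O P by (auto simp: is_poset_iff)
  have L_iff: "W \<in> ?L \<longleftrightarrow> W \<subseteq> X \<union> Y \<and>
      (\<forall>x y. y \<in> W \<longrightarrow> (x, y) \<in> leO \<union> R \<union> leP \<longrightarrow> x \<in> W)" for W
    using O_sub P_sub R unfolding osum_def fst_conv snd_conv mem_downsets_iff by blast
  show ?thesis
  proof (intro equalityI subsetI)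
    fix W assume "W \<in> ?L"
    then have W: "W \<subseteq> X \<union> Y"
      and down: "\<And>x y. y \<in> W \<Longrightarrow> (x, y) \<in> leO \<union> R \<union> leP \<Longrightarrow> x \<in> W"
      unfolding L_iff by blast+
    let ?D = "W \<inter> Y"
    let ?E = "W \<inter> X - rel_pre R ?D"
    have "?D \<in> downsets (Y, leP)"
      using down unfolding mem_downsets_iff by blast
    moreover have "?E \<in> downsets (pos_minus (X, leO) (rel_pre R ?D))"
      using down unfolding mem_downsets_pos_minus_iff by blast
    \<comment> \<open>Closure of \<open>W\<close> under \<open>R\<close> puts
      \<open>rel_pre R ?D\<close> inside \<open>W\<close>, so the union on the right adds nothing
      new.\<close>
    moreover have "W = ?D \<union> rel_pre R ?D \<union> ?E"
      using W down by blast
    ultimately show "W \<in> (\<Union>D\<in>downsets (Y, leP). ?F D)"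
      by blast
  next
    fix W assume "W \<in> (\<Union>D\<in>downsets (Y, leP). ?F D)"
    then obtain D E where D: "D \<in> downsets (Y, leP)"
      and E: "E \<in> downsets (pos_minus (X, leO) (rel_pre R D))"
      and W: "W = D \<union> rel_pre R D \<union> E"
      by blast
    have D_sub: "D \<subseteq> Y" and E_sub: "E \<subseteq> X"
      using D E unfolding mem_downsets_iff mem_downsets_pos_minus_iff by blast+
    \<comment> \<open>Below a point of \<open>rel_pre R D\<close> one stays in that set by
      \<open>leO O R \<subseteq> R\<close>. Below a point of \<open>E\<close> one either enters
      \<open>rel_pre R D\<close> or remains in the reduced poset, where \<open>E\<close> is
      closed.\<close>
    have "x \<in> W" if "y \<in> W" "(x, y) \<in> leO" for x y
    proof -
      have "x \<in> X" "y \<in> X"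
        using that O_sub by blast+
      then have "y \<in> rel_pre R D \<or> y \<in> E"
        using that D_sub disj W by blast
      moreover have "x \<in> rel_pre R D" if "y \<in> rel_pre R D"
        using that \<open>(x, y) \<in> leO\<close> comp by blast
      moreover have "x \<in> rel_pre R D \<union> E" if "y \<in> E"
        using that E \<open>(x, y) \<in> leO\<close> \<open>x \<in> X\<close> unfolding mem_downsets_pos_minus_iff by blast
      ultimately show ?thesis
        using W by blast
    qed
    moreover have "x \<in> W" if "y \<in> W" "(x, y) \<in> R" for x y
    proof -
      \<comment> \<open>The upper end of an \<open>R\<close>-pair lies in \<open>Y\<close>, and the
        only part of \<open>W\<close> in \<open>Y\<close> is \<open>D\<close>.\<close>
      have "y \<in> D"
        using that R E_sub disj W by blast
      then show ?thesis
        using that W by blast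
    qed
    moreover have "x \<in> W" if "y \<in> W" "(x, y) \<in> leP" for x y
    proof -
      have "x \<in> Y" "y \<in> D"
        using that P_sub R E_sub disj W by blast+
      then show ?thesis
        using that D W unfolding mem_downsets_iff by blast
    qed
    moreover have "W \<subseteq> X \<union> Y"
      using W D_sub E_sub R by blast
    ultimately show "W \<in> ?L"
      unfolding L_iff by blast
  qed
qed

lemma disjoint_family_downsets_osum:
  assumes disj: "X \<inter> Y = {}" and R: "R \<subseteq> X \<times> Y"
  shows "disjoint_family_on
    (\<lambda>D. {D \<union> rel_pre R D \<union> E | E. E \<in> downsets (pos_minus (X, leO) (rel_pre R D))})
    (downsets (Y, leP))"
    (is "disjoint_family_on ?F _")
proof -
  \<comment> \<open>Both \<open>rel_pre R D\<close> and \<open>E\<close> lie in \<open>X\<close>, so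
    intersecting with \<open>Y\<close> leaves just \<open>D\<close>.\<close>
  have trace: "W \<inter> Y = D" if "D \<in> downsets (Y, leP)" "W \<in> ?F D" for W D
  proof -
    obtain E where "E \<in> downsets (pos_minus (X, leO) (rel_pre R D))"
      and "W = D \<union> rel_pre R D \<union> E"
      using \<open>W \<in> ?F D\<close> by blast
    then show ?thesis
      using that(1) disj R unfolding mem_downsets_iff mem_downsets_pos_minus_iff by blast
  qed
  show ?thesis
    unfolding disjoint_family_on_def
  proof (intro ballI impI equals0I)
    fix D D' W
    assume D: "D \<in> downsets (Y, leP)" "D' \<in> downsets (Y, leP)" and "D \<noteq> D'"
      and W: "W \<in> ?F D \<inter> ?F D'"
    have "D = D'"
      using trace[OF D(1) IntD1[OF W]] trace[OF D(2) IntD2[OF W]] by simp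
    with \<open>D \<noteq> D'\<close> show False ..
  qed
qed

lemma card_downsets_osum_fibre:
  assumes disj: "X \<inter> Y = {}" and D: "D \<subseteq> Y"
  shows "card {D \<union> rel_pre R D \<union> E | E. E \<in> downsets (pos_minus (X, leO) (rel_pre R D))} =
    num_downsets (pos_minus (X, leO) (rel_pre R D))"
proof -
  let ?\<D> = "downsets (pos_minus (X, leO) (rel_pre R D))"
  \<comment> \<open>\<open>E\<close> misses \<open>D\<close> because it lies in \<open>X\<close>,
    and misses \<open>rel_pre R D\<close> because that set was removed. Set difference is thus a
    left inverse of the map from \<open>E\<close> to the downset of the sum.\<close>
  have "(D \<union> rel_pre R D \<union> E) - (D \<union> rel_pre R D) = E" if "E \<in> ?\<D>" for E
    using that assms unfolding mem_downsets_pos_minus_iff by blast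
  then have "inj_on (\<lambda>E. D \<union> rel_pre R D \<union> E) ?\<D>"
    by (rule inj_on_inverseI[where g = "\<lambda>W. W - (D \<union> rel_pre R D)"])
  then show ?thesis
    unfolding num_downsets_def Setcompr_eq_image by (rule card_image)
qed

theorem theorem3p3:
  fixes X Y :: "'a set" and leO leP R :: "'a rel"
  assumes "is_poset (X, leO)" and "is_poset (Y, leP)"
    and "X \<inter> Y = {}"
    and "R \<subseteq> X \<times> Y"
    and "(leO O R) \<union> (R O leP) \<subseteq> R"
  shows "is_poset (osum (X, leO) R (Y, leP)) \<and>
    downsets (osum (X, leO) R (Y, leP)) =
      (\<Union>D\<in>downsets (Y, leP).
         {D \<union> rel_pre R D \<union> E | E. E \<in> downsets (pos_minus (X, leO) (rel_pre R D))}) \<and>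
    disjoint_family_on
      (\<lambda>D. {D \<union> rel_pre R D \<union> E | E. E \<in> downsets (pos_minus (X, leO) (rel_pre R D))})
      (downsets (Y, leP)) \<and>
    (finite X \<and> finite Y \<longrightarrow>
      num_downsets (osum (X, leO) R (Y, leP)) =
        (\<Sum>D\<in>downsets (Y, leP). num_downsets (pos_minus (X, leO) (rel_pre R D))))"
proof -
  let ?F = "\<lambda>D. {D \<union> rel_pre R D \<union> E | E. E \<in> downsets (pos_minus (X, leO) (rel_pre R D))}"
  have union: "downsets (osum (X, leO) R (Y, leP)) = (\<Union>D\<in>downsets (Y, leP). ?F D)"
    using assms by (rule downsets_osum)
  have disj: "disjoint_family_on ?F (downsets (Y, leP))"
    using assms(3,4) by (rule disjoint_family_downsets_osum)
  have "num_downsets (osum (X, leO) R (Y, leP)) =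
      (\<Sum>D\<in>downsets (Y, leP). num_downsets (pos_minus (X, leO) (rel_pre R D)))"
    if fin: "finite X" "finite Y"
  proof -
    have "num_downsets (osum (X, leO) R (Y, leP)) = (\<Sum>D\<in>downsets (Y, leP). card (?F D))"
      unfolding num_downsets_def union
    proof (rule card_UN_disjoint)
      show "finite (downsets (Y, leP))"
        using fin by (simp add: finite_downsets)
      show "\<forall>D\<in>downsets (Y, leP). finite (?F D)"
        \<comment> \<open>Each \<open>?F D\<close> is the image of a set of downsets of a subposet
          on part of the finite set \<open>X\<close>.\<close>
        using fin by (simp add: finite_downsets_pos_minus)
      show "\<forall>D\<in>downsets (Y, leP). \<forall>D'\<in>downsets (Y, leP). D \<noteq> D' \<longrightarrow> ?F D \<inter> ?F D' = {}"
        using disj unfolding disjoint_family_on_def .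
    qed
    also have "\<dots> = (\<Sum>D\<in>downsets (Y, leP). num_downsets (pos_minus (X, leO) (rel_pre R D)))"
      using assms(3) by (intro sum.cong refl card_downsets_osum_fibre) (auto simp: mem_downsets_iff)
    finally show ?thesis .
  qed
  then have count: "finite X \<and> finite Y \<longrightarrow> num_downsets (osum (X, leO) R (Y, leP)) =
      (\<Sum>D\<in>downsets (Y, leP). num_downsets (pos_minus (X, leO) (rel_pre R D)))"
    by simp
  show ?thesis
    by (intro conjI is_poset_osum[OF assms] union disj count)
qed

end
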